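(* Let $N\ge1$ be an integer and let $\varphi_i^{(n)}=\varphi_i^{(n)}(X,T,S)$, $1\le i\le N$, $n\in\mathbb{Z}$, be smooth functions satisfying the linear dispersion relations $$\frac{\partial\varphi_i^{(n)}}{\partial X}=\varphi_i^{(n+1)},\qquad \frac{\partial\varphi_i^{(n)}}{\partial T}=\varphi_i^{(n-1)},\qquad \frac{\partial\varphi_i^{(n)}}{\partial S}=\varphi_i^{(n-2)} .$$ Let $$\tau_n=\det\bigl(\varphi_i^{(n+j-1)}\bigr)_{1\le i,j\le N},\qquad f=\tau_0,\quad g=\tau_1 .$$ Then $f,g$ satisfy the bilinear equations $$(D_T^2+D_S)\,g\cdot f=0,\qquad \bigl(D_X(D_T^2+D_S)-4D_T\bigr)\,g\cdot f=0 .$$ In particular, for nonzero constants $p_i,q_i$ and arbitrary phase constants $\xi_{i,0},\eta_{i,0}$, the functions $$\varphi_i^{(n)}=p_i^{n}e^{p_iX+\frac1{p_i}T+\frac1{p_i^2}S+\xi_{i,0}}+q_i^{n}e^{q_iX+\frac1{q_i}T+\frac1{q_i^2}S+\eta_{i,0}}$$ satisfy the linear dispersion relations, and so yield solutions ($N$-soliton solutions) of the bilinear equations.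
   Context: Hirota bilinear operators: for smooth functions $g,f$ of $(X,T,S)$, $$D_X^lD_T^mD_S^r\,g\cdot f=\left.(\partial_X-\partial_{X'})^l(\partial_T-\partial_{T'})^m(\partial_S-\partial_{S'})^r\,g(X,T,S)f(X',T',S')\right|_{X'=X,\,T'=T,\,S'=S},$$ extended linearly to polynomials in $D_X,D_T,D_S$. Here $X,T,S$ are real variables; functions and constants may be real- or complex-valued. *)

theory Defs
  imports
    "HOL-Analysis.Analysis"
    "HOL-Library.Poly_Mapping"
    "Jordan_Normal_Form.Determinant"
begin

text \<open>
  Functions of the real variables \<open>(X, T, S)\<close> take values in a type of sort
  \<open>{real_normed_field, banach}\<close>; \<open>real\<close> and \<open>complex\<close> are both instances.
\<close>

type_synonym 'a fun3 = "real \<times> real \<times> real \<Rightarrow> 'a"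

primrec times_differentiable ::
    "nat \<Rightarrow> ('b::real_normed_vector \<Rightarrow> 'c::real_normed_vector) \<Rightarrow> bool" where
  "times_differentiable 0 f \<longleftrightarrow> continuous_on UNIV f"
| "times_differentiable (Suc k) f \<longleftrightarrow>
     (\<forall>x. f differentiable (at x)) \<and>
     (\<forall>v. times_differentiable k (\<lambda>x. frechet_derivative f (at x) v))"

definition smooth :: "('b::real_normed_vector \<Rightarrow> 'c::real_normed_vector) \<Rightarrow> bool" where
  "smooth f \<longleftrightarrow> (\<forall>k. times_differentiable k f)"

definition partial_X :: "'a::real_normed_vector fun3 \<Rightarrow> 'a fun3" where
  "partial_X F = (\<lambda>(X, T, S). vector_derivative (\<lambda>x. F (x, T, S)) (at X))"

definition partial_T :: "'a::real_normed_vector fun3 \<Rightarrow> 'a fun3" where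
  "partial_T F = (\<lambda>(X, T, S). vector_derivative (\<lambda>t. F (X, t, S)) (at T))"

definition partial_S :: "'a::real_normed_vector fun3 \<Rightarrow> 'a fun3" where
  "partial_S F = (\<lambda>(X, T, S). vector_derivative (\<lambda>s. F (X, T, s)) (at S))"

text \<open>
  For a partial derivative \<open>\<delta>\<close>, the operator \<open>\<delta> - \<delta>'\<close> on functions
  \<open>G (X, T, S) (X', T', S')\<close> of two copies of the variables.
\<close>

definition doubled_diff ::
    "('a::real_normed_vector fun3 \<Rightarrow> 'a fun3) \<Rightarrow> 'a fun3 fun3 \<Rightarrow> 'a fun3 fun3" where
  "doubled_diff \<delta> G = (\<lambda>P P'. \<delta> (\<lambda>Q. G Q P') P - \<delta> (\<lambda>Q'. G P Q') P')"

definition hirota_monom ::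
    "nat \<Rightarrow> nat \<Rightarrow> nat \<Rightarrow> 'a::real_normed_field fun3 \<Rightarrow> 'a fun3 \<Rightarrow> 'a fun3" where
  "hirota_monom l m r g f = (\<lambda>P.
     (doubled_diff partial_X ^^ l)
       ((doubled_diff partial_T ^^ m)
         ((doubled_diff partial_S ^^ r) (\<lambda>Q Q'. g Q * f Q'))) P P)"

text \<open>
  Polynomials in \<open>D\<^sub>X, D\<^sub>T, D\<^sub>S\<close> are finitely supported coefficient families indexed by
  the exponents \<open>(l, m, r)\<close>; their product is convolution, since exponents add componentwise.
\<close>

type_synonym 'a hirota_poly = "(nat \<times> nat \<times> nat) \<Rightarrow>\<^sub>0 'a"

definition D_X :: "'a::comm_ring_1 hirota_poly" where
  "D_X = Poly_Mapping.single (1, 0, 0) 1"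

definition D_T :: "'a::comm_ring_1 hirota_poly" where
  "D_T = Poly_Mapping.single (0, 1, 0) 1"

definition D_S :: "'a::comm_ring_1 hirota_poly" where
  "D_S = Poly_Mapping.single (0, 0, 1) 1"

definition hirota ::
    "'a::real_normed_field hirota_poly \<Rightarrow> 'a fun3 \<Rightarrow> 'a fun3 \<Rightarrow> 'a fun3" where
  "hirota p g f = (\<lambda>P.
     \<Sum>(l, m, r)\<in>Poly_Mapping.keys p. Poly_Mapping.lookup p (l, m, r) * hirota_monom l m r g f P)"

definition dispersion_relations :: "nat \<Rightarrow> (nat \<Rightarrow> int \<Rightarrow> 'a::real_normed_field fun3) \<Rightarrow> bool" where
  "dispersion_relations N \<phi> \<longleftrightarrow> (\<forall>i\<in>{1..N}. \<forall>n X T S.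
     ((\<lambda>x. \<phi> i n (x, T, S)) has_vector_derivative \<phi> i (n + 1) (X, T, S)) (at X) \<and>
     ((\<lambda>t. \<phi> i n (X, t, S)) has_vector_derivative \<phi> i (n - 1) (X, T, S)) (at T) \<and>
     ((\<lambda>s. \<phi> i n (X, T, s)) has_vector_derivative \<phi> i (n - 2) (X, T, S)) (at S))"

text \<open>
  Matrix indices in \<open>mat\<close> start at \<open>0\<close>: entry \<open>(i, j)\<close> below is the entry in row \<open>i + 1\<close>
  and column \<open>j + 1\<close>, so that the upper index \<open>n + (j + 1) - 1\<close> becomes \<open>n + j\<close>.
\<close>

definition tau :: "nat \<Rightarrow> (nat \<Rightarrow> int \<Rightarrow> 'a::real_normed_field fun3) \<Rightarrow> int \<Rightarrow> 'a fun3" where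
  "tau N \<phi> n = (\<lambda>P. Determinant.det (mat N N (\<lambda>(i, j). \<phi> (i + 1) (n + int j) P)))"

definition solves_bilinear_equations :: "'a::real_normed_field fun3 \<Rightarrow> 'a fun3 \<Rightarrow> bool" where
  "solves_bilinear_equations g f \<longleftrightarrow>
     (\<forall>P. hirota (D_T^2 + D_S) g f P = 0) \<and>
     (\<forall>P. hirota (D_X * (D_T^2 + D_S) - 4 * D_T) g f P = 0)"

definition soliton_phi ::
    "(nat \<Rightarrow> 'a) \<Rightarrow> (nat \<Rightarrow> 'a) \<Rightarrow> (nat \<Rightarrow> 'a) \<Rightarrow> (nat \<Rightarrow> 'a) \<Rightarrow>
     nat \<Rightarrow> int \<Rightarrow> 'a::{real_normed_field, banach} fun3" where
  "soliton_phi p q \<xi> \<eta> i n = (\<lambda>(X, T, S).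
     p i powi n * exp (p i * of_real X + 1 / p i * of_real T + 1 / (p i)^2 * of_real S + \<xi> i) +
     q i powi n * exp (q i * of_real X + 1 / q i * of_real T + 1 / (q i)^2 * of_real S + \<eta> i))"

end

theory Submission
  imports Defs
begin

text \<open>
  Write \<open>[c\<^sub>0, ..., c\<^sub>N\<^sub>-\<^sub>1]\<close> for the determinant whose columns carry the upper indices \<open>c\<^sub>j\<close>, so that
  \<open>\<tau>\<^sub>n = [n, ..., n + N - 1]\<close>. A derivative is the sum over the columns of the determinants with
  that one column shifted; for (nearly) consecutive indices almost all of them have a repeated
  column. One gets \<open>\<partial>\<^sub>T\<^sup>2 \<tau>\<^sub>n = A\<^sub>n + B\<^sub>n\<close> and \<open>\<partial>\<^sub>S \<tau>\<^sub>n = A\<^sub>n - B\<^sub>n\<close> with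
  \<open>A\<^sub>n = [n-2, n+1, ..., n+N-1]\<close> and \<open>B\<^sub>n = [n-1, n, n+2, ..., n+N-1]\<close>, and the first equation
  becomes the Pluecker relation
  \<open>A\<^sub>1 \<tau>\<^sub>0 - \<partial>\<^sub>T\<tau>\<^sub>1 \<partial>\<^sub>T\<tau>\<^sub>0 + \<tau>\<^sub>1 B\<^sub>0 = 0\<close>. In the second equation the terms in which \<open>\<partial>\<^sub>X\<close> hits one
  of the first two columns produce \<open>4 D\<^sub>T \<tau>\<^sub>1 \<cdot> \<tau>\<^sub>0\<close>, and those in which it hits the last column
  form the difference of two further Pluecker relations.
\<close>

subsection \<open>Pluecker relations\<close>

text \<open>Columns are functions on a sequence of positions, so replacing a column is a function
  update and reordering or omitting columns is a composition.\<close>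

definition col_det :: "nat \<Rightarrow> (nat \<Rightarrow> nat \<Rightarrow> 'a::comm_ring_1) \<Rightarrow> 'a" where
  "col_det N w = Determinant.det (mat N N (\<lambda>(i, j). w j i))"

lemma col_det_cong:
  assumes "\<And>i j. i < N \<Longrightarrow> j < N \<Longrightarrow> w j i = w' j i"
  shows "col_det N w = col_det N w'"
  unfolding col_det_def by (rule arg_cong[of _ _ Determinant.det]) (auto intro!: eq_matI simp: assms)

lemma col_det_repeat:
  assumes "i < N" "j < N" "i \<noteq> j" "w i = w j"
  shows "col_det N w = 0"
  unfolding col_det_def
  by (rule Determinant.det_identical_columns[of _ N i j]) (use assms in \<open>auto intro!: eq_vecI\<close>)

lemma col_det_swap:
  assumes "i < N" "j < N" "i \<noteq> j"
  shows "col_det N (w \<circ> Transposition.transpose i j) = - col_det N w"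
proof -
  have "mat N N (\<lambda>(k, l). (w \<circ> Transposition.transpose i j) l k)
      = swapcols i j (mat N N (\<lambda>(k, l). w l k))"
    using assms by (auto intro!: eq_matI simp: Transposition.transpose_def)
  then show ?thesis
    unfolding col_det_def using assms by (simp add: det_swapcols[of i N j])
qed

lemma col_det_Leibniz:
  "col_det N w = (\<Sum>p | p permutes {0..<N}. signof p * (\<Prod>j<N. w j (p j)))"
proof -
  have "(\<Prod>j<N. mat N N (\<lambda>(i, j). w j i) $$ (p j, j)) = (\<Prod>j<N. w j (p j))"
    if "p permutes {0..<N}" for p
    by (rule prod.cong) (use permutes_in_image[OF that] in auto)
  then show ?thesis
    unfolding col_det_def by (subst det_col[of _ N]) (auto intro!: sum.cong)
qed

text \<open>The increasing enumeration of the naturals other than \<open>j\<close>: if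
  \<open>w\<close> lists \<open>N + 1\<close> columns, \<open>w \<circ> skip j\<close> lists the
  \<open>N\<close> left after dropping column \<open>j\<close>.\<close>

definition skip :: "nat \<Rightarrow> nat \<Rightarrow> nat" where
  "skip j k = (if k < j then k else Suc k)"

text \<open>Prepend a copy of row \<open>r\<close> to the rectangular matrix and expand along that row.\<close>

lemma sum_omit_column:
  assumes "r < N"
  shows "(\<Sum>j<Suc N. (-1) ^ j * col_det N (w \<circ> skip j) * w j r) = 0"
proof -
  define M where "M = mat (Suc N) (Suc N) (\<lambda>(i, j). w j (case i of 0 \<Rightarrow> r | Suc i' \<Rightarrow> i'))"
  have M: "M \<in> carrier_mat (Suc N) (Suc N)"
    by (simp add: M_def)
  have "Determinant.det M = 0"
    by (rule Determinant.det_identical_rows[OF M, of 0 "Suc r"])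
      (use assms in \<open>auto intro!: eq_vecI simp: M_def\<close>)
  moreover have "mat_delete M 0 j = mat N N (\<lambda>(i, k). (w \<circ> skip j) k i)" for j
    by (rule eq_matI) (auto simp: M_def mat_delete_def skip_def)
  then have "M $$ (0, j) * cofactor M 0 j = (-1) ^ j * col_det N (w \<circ> skip j) * w j r"
    if "j < Suc N" for j
    using that by (simp add: cofactor_def col_det_def) (simp add: M_def)
  ultimately show ?thesis
    using laplace_expansion_row[OF M, of 0] by simp
qed

text \<open>Laplace expansion along column \<open>k\<close>: its cofactors are computed with that
  column deleted, so they do not depend on \<open>v\<close>.\<close>

lemma col_det_expand:
  assumes "k < N"
  obtains C where "\<And>v. col_det N (y(k := v)) = (\<Sum>r<N. v r * C r)"
proof
  fix v
  define M where "M v = mat N N (\<lambda>(i, j). (y(k := v)) j i)" for v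
  have "cofactor (M v) r k = cofactor (M (y k)) r k" for r
    unfolding cofactor_def
    by (rule arg_cong[where f = "\<lambda>A. _ * Determinant.det A"])
      (rule eq_matI, auto simp: M_def mat_delete_def)
  then have "M v $$ (r, k) * cofactor (M v) r k = v r * cofactor (M (y k)) r k" if "r < N" for r
    using that assms by (simp add: M_def)
  moreover have "Determinant.det (M v) = (\<Sum>r<N. M v $$ (r, k) * cofactor (M v) r k)"
    using laplace_expansion_column[of "M v" N k] assms by (simp add: M_def)
  ultimately show "col_det N (y(k := v)) = (\<Sum>r<N. v r * cofactor (M (y k)) r k)"
    by (simp add: col_det_def M_def)
qed

text \<open>\<open>sum_omit_column\<close> is a linear dependence among the \<open>N + 1\<close>
  vectors \<open>w j\<close>, coordinate by coordinate; the linear functional sending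
  \<open>v\<close> to \<open>col_det N (y(k := v))\<close> is applied to it.\<close>

lemma pluecker_relation:
  assumes "k < N"
  shows "(\<Sum>j<Suc N. (-1) ^ j * col_det N (w \<circ> skip j) * col_det N (y(k := w j))) = 0"
proof -
  obtain C where C: "\<And>v. col_det N (y(k := v)) = (\<Sum>r<N. v r * C r)"
    using col_det_expand[OF assms] by blast
  have "(\<Sum>j<Suc N. (-1) ^ j * col_det N (w \<circ> skip j) * col_det N (y(k := w j)))
      = (\<Sum>j<Suc N. \<Sum>r<N. C r * ((-1) ^ j * col_det N (w \<circ> skip j) * w j r))"
    by (simp only: C sum_distrib_left mult_ac)
  also have "\<dots> = (\<Sum>r<N. C r * (\<Sum>j<Suc N. (-1) ^ j * col_det N (w \<circ> skip j) * w j r))"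
    by (subst sum.swap) (simp only: sum_distrib_left)
  also have "\<dots> = 0"
    by (rule sum.neutral) (simp add: sum_omit_column del: sum.lessThan_Suc)
  finally show ?thesis .
qed

text \<open>From \<open>j = 3\<close> on, \<open>w j\<close> already occurs among the other columns
  of \<open>y\<close>, so the second determinant of the summand has a repeated column.\<close>

lemma pluecker_three_term:
  assumes "2 \<le> N" "k < N" and "\<And>j. 3 \<le> j \<Longrightarrow> j \<le> N \<Longrightarrow> \<exists>l<N. l \<noteq> k \<and> y l = w j"
  shows "col_det N (w \<circ> skip 0) * col_det N (y(k := w 0))
       - col_det N (w \<circ> skip 1) * col_det N (y(k := w 1))
       + col_det N (w \<circ> skip 2) * col_det N (y(k := w 2)) = 0"
proof -
  let ?t = "\<lambda>j. (-1) ^ j * col_det N (w \<circ> skip j) * col_det N (y(k := w j))"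
  have "?t j = 0" if "j \<in> {..<Suc N} - {..<3}" for j
  proof -
    have "3 \<le> j" "j \<le> N"
      using that by auto
    then obtain l where "l < N" "l \<noteq> k" "y l = w j"
      using assms(3) by blast
    then show ?thesis
      using col_det_repeat[of k N l "y(k := w j)"] \<open>k < N\<close> by simp
  qed
  then have "sum ?t {..<Suc N} = sum ?t {..<3}"
    using \<open>2 \<le> N\<close> by (intro sum.mono_neutral_right) auto
  then show ?thesis
    using pluecker_relation[OF \<open>k < N\<close>, of w y] by (simp add: numeral_3_eq_3 numeral_2_eq_2)
qed

subsection \<open>Partial derivatives and Hirota operators\<close>

text \<open>A derivative along a direction \<open>e\<close>, so that the rules below serve all three
  variables at once and carry existence along with the value.\<close>

definition has_partial ::
    "real \<times> real \<times> real \<Rightarrow> 'a::real_normed_vector fun3 \<Rightarrow> 'a fun3 \<Rightarrow> bool" where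
  "has_partial e F F' \<longleftrightarrow> (\<forall>P. ((\<lambda>t. F (P + t *\<^sub>R e)) has_vector_derivative F' P) (at 0))"

lemma has_vector_derivative_shift_0:
  "((\<lambda>t. f (x + t)) has_vector_derivative d) (at 0) \<longleftrightarrow> (f has_vector_derivative d) (at x)"
proof
  assume "((\<lambda>t. f (x + t)) has_vector_derivative d) (at 0)"
  moreover have "((\<lambda>t. t - x) has_vector_derivative 1) (at x)"
    by (auto intro!: derivative_eq_intros)
  ultimately show "(f has_vector_derivative d) (at x)"
    using vector_diff_chain_at[of "\<lambda>t. t - x" 1 x "\<lambda>t. f (x + t)" d] by (simp add: o_def)
next
  assume "(f has_vector_derivative d) (at x)"
  moreover have "((\<lambda>t. x + t) has_vector_derivative 1) (at 0)"
    by (auto intro!: derivative_eq_intros)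
  ultimately show "((\<lambda>t. f (x + t)) has_vector_derivative d) (at 0)"
    using vector_diff_chain_at[of "\<lambda>t. x + t" 1 0 f d] by (simp add: o_def)
qed

lemma has_partial_X_iff:
  "has_partial (1, 0, 0) F F' \<longleftrightarrow>
    (\<forall>X T S. ((\<lambda>x. F (x, T, S)) has_vector_derivative F' (X, T, S)) (at X))"
  using has_vector_derivative_shift_0[of "\<lambda>x. F (x, _, _)"] by (simp add: has_partial_def)

lemma has_partial_T_iff:
  "has_partial (0, 1, 0) F F' \<longleftrightarrow>
    (\<forall>X T S. ((\<lambda>t. F (X, t, S)) has_vector_derivative F' (X, T, S)) (at T))"
  using has_vector_derivative_shift_0[of "\<lambda>t. F (_, t, _)"] by (simp add: has_partial_def)

lemma has_partial_S_iff:
  "has_partial (0, 0, 1) F F' \<longleftrightarrow>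
    (\<forall>X T S. ((\<lambda>s. F (X, T, s)) has_vector_derivative F' (X, T, S)) (at S))"
  using has_vector_derivative_shift_0[of "\<lambda>s. F (_, _, s)"] by (simp add: has_partial_def)

definition computes_partial ::
    "('a::real_normed_vector fun3 \<Rightarrow> 'a fun3) \<Rightarrow> real \<times> real \<times> real \<Rightarrow> bool" where
  "computes_partial \<delta> e \<longleftrightarrow> (\<forall>F F'. has_partial e F F' \<longrightarrow> \<delta> F = F')"

lemma computes_partial_X: "computes_partial partial_X (1, 0, 0)"
  by (auto simp: computes_partial_def has_partial_X_iff partial_X_def vector_derivative_at)

lemma computes_partial_T: "computes_partial partial_T (0, 1, 0)"
  by (auto simp: computes_partial_def has_partial_T_iff partial_T_def vector_derivative_at)

lemma computes_partial_S: "computes_partial partial_S (0, 0, 1)"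
  by (auto simp: computes_partial_def has_partial_S_iff partial_S_def vector_derivative_at)

lemma has_partial_add:
  "has_partial e F F' \<Longrightarrow> has_partial e G G' \<Longrightarrow>
    has_partial e (\<lambda>P. F P + G P) (\<lambda>P. F' P + G' P)"
  by (auto simp: has_partial_def intro: has_vector_derivative_add)

lemma has_partial_diff:
  "has_partial e F F' \<Longrightarrow> has_partial e G G' \<Longrightarrow>
    has_partial e (\<lambda>P. F P - G P) (\<lambda>P. F' P - G' P)"
  by (auto simp: has_partial_def intro: has_vector_derivative_diff)

lemma has_partial_mult_left:
  fixes F :: "'a::real_normed_algebra fun3"
  shows "has_partial e F F' \<Longrightarrow> has_partial e (\<lambda>P. F P * c) (\<lambda>P. F' P * c)"
  by (auto simp: has_partial_def intro: has_vector_derivative_mult_left)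

lemma has_partial_mult_right:
  fixes F :: "'a::real_normed_algebra fun3"
  shows "has_partial e F F' \<Longrightarrow> has_partial e (\<lambda>P. c * F P) (\<lambda>P. c * F' P)"
  by (auto simp: has_partial_def intro: has_vector_derivative_mult_right)

lemma has_partial_sum:
  "(\<And>i. i \<in> I \<Longrightarrow> has_partial e (F i) (F' i)) \<Longrightarrow>
    has_partial e (\<lambda>P. \<Sum>i\<in>I. F i P) (\<lambda>P. \<Sum>i\<in>I. F' i P)"
  by (auto simp: has_partial_def intro: has_vector_derivative_sum)

lemma has_partial_prod:
  fixes F :: "'i \<Rightarrow> 'a::real_normed_field fun3"
  assumes "\<And>i. i \<in> I \<Longrightarrow> has_partial e (F i) (F' i)"
  shows "has_partial e (\<lambda>P. \<Prod>i\<in>I. F i P) (\<lambda>P. \<Sum>i\<in>I. F' i P * (\<Prod>j\<in>I - {i}. F j P))"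
  unfolding has_partial_def
proof
  fix P
  have "((\<lambda>t. \<Prod>i\<in>I. F i (P + t *\<^sub>R e)) has_derivative
      (\<lambda>y. \<Sum>i\<in>I. y *\<^sub>R F' i P * (\<Prod>j\<in>I - {i}. F j (P + 0 *\<^sub>R e)))) (at 0)"
    by (rule has_derivative_prod, rule assms[unfolded has_partial_def has_vector_derivative_def, rule_format])
  then show "((\<lambda>t. \<Prod>i\<in>I. F i (P + t *\<^sub>R e)) has_vector_derivative
      (\<Sum>i\<in>I. F' i P * (\<Prod>j\<in>I - {i}. F j P))) (at 0)"
    by (simp add: has_vector_derivative_def scaleR_sum_right)
qed

lemmas has_partial_intros =
  has_partial_add has_partial_diff has_partial_mult_left has_partial_mult_right

section \<open>The doubled operators on combinations of products \<open>g P * f P'\<close>\<close>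

lemma doubled_diff_eqI:
  assumes "computes_partial \<delta> e"
    and "\<And>P'. has_partial e (\<lambda>P. G P P') (\<lambda>P. G1 P P')"
    and "\<And>P. has_partial e (G P) (G2 P)"
  shows "doubled_diff \<delta> G = (\<lambda>P P'. G1 P P' - G2 P P')"
proof -
  have "\<delta> (\<lambda>P. G P P') = (\<lambda>P. G1 P P')" "\<delta> (G P) = G2 P" for P P'
    using assms unfolding computes_partial_def by blast+
  then show ?thesis
    by (simp add: doubled_diff_def fun_eq_iff)
qed

lemma doubled_diff_tensor:
  fixes g f :: "'a::real_normed_field fun3"
  assumes "computes_partial \<delta> e"
    and "has_partial e g g'" "has_partial e f f'"
  shows "doubled_diff \<delta> (\<lambda>P P'. g P * f P') = (\<lambda>P P'. g' P * f P' - g P * f' P')"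
  by (rule doubled_diff_eqI[OF assms(1)]) (intro has_partial_intros assms)+

lemma doubled_diff_tensor2:
  fixes g f :: "'a::real_normed_field fun3"
  assumes "computes_partial \<delta> e"
    and "has_partial e g g'" "has_partial e f f'" "has_partial e h h'" "has_partial e k k'"
  shows "doubled_diff \<delta> (\<lambda>P P'. g P * f P' - h P * k P')
      = (\<lambda>P P'. (g' P * f P' - h' P * k P') - (g P * f' P' - h P * k' P'))"
  by (rule doubled_diff_eqI[OF assms(1)]) (intro has_partial_intros assms)+

text \<open>The argument has the shape of two applications of the doubled T-operator to
  \<open>g P * f P'\<close>, before the two points are identified; the mixed product
  \<open>h P * k P'\<close> arises twice.\<close>

lemma doubled_diff_tensor4:
  fixes g f :: "'a::real_normed_field fun3"
  assumes "computes_partial \<delta> e"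
    and "has_partial e g g'" "has_partial e f f'" "has_partial e h h'" "has_partial e k k'"
    and "has_partial e m m'" "has_partial e n n'"
  shows "doubled_diff \<delta> (\<lambda>P P'. (g P * f P' - h P * k P') - (h P * k P' - m P * n P'))
      = (\<lambda>P P'. ((g' P * f P' - h' P * k P') - (h' P * k P' - m' P * n P'))
              - ((g P * f' P' - h P * k' P') - (h P * k' P' - m P * n' P')))"
  by (rule doubled_diff_eqI[OF assms(1)]) (intro has_partial_intros assms)+

section \<open>Linearity of \<open>hirota\<close> in the polynomial, and the two operators in terms
  of monomials\<close>

text \<open>Cancellation may shrink the set of keys of a sum; a larger index set lets both summands
  and the sum be evaluated over the same exponents.\<close>

lemma hirota_eq_sum:
  assumes "finite K" "Poly_Mapping.keys p \<subseteq> K"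
  shows "hirota p g f P =
    (\<Sum>k\<in>K. Poly_Mapping.lookup p k * (case k of (l, m, r) \<Rightarrow> hirota_monom l m r g f P))"
  unfolding hirota_def
  by (rule sum.mono_neutral_cong_left) (use assms in \<open>auto simp: in_keys_iff\<close>)

lemma hirota_add: "hirota (p + q) g f P = hirota p g f P + hirota q g f P"
proof -
  let ?K = "Poly_Mapping.keys p \<union> Poly_Mapping.keys q"
  have "finite ?K" "Poly_Mapping.keys (p + q) \<subseteq> ?K"
    using keys_add[of p q] by auto
  then show ?thesis
    by (simp add: hirota_eq_sum[of ?K] lookup_add distrib_right sum.distrib)
qed

lemma hirota_uminus: "hirota (- p) g f P = - hirota p g f P"
proof -
  have "Poly_Mapping.keys (- p) \<subseteq> Poly_Mapping.keys p"
    by (simp add: subset_iff in_keys_iff)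
  then show ?thesis
    by (simp add: hirota_eq_sum[of "Poly_Mapping.keys p"] sum_negf)
qed

lemma hirota_single: "hirota (Poly_Mapping.single (l, m, r) c) g f P = c * hirota_monom l m r g f P"
  by (simp add: hirota_eq_sum[of "{(l, m, r)}"])

lemma hirota_D_T2_D_S:
  "hirota (D_T^2 + D_S) g f P = hirota_monom 0 2 0 g f P + hirota_monom 0 0 1 g f P"
  by (simp add: D_T_def D_S_def power2_eq_square mult_single hirota_add hirota_single numeral_2_eq_2)

lemma hirota_D_X_D_T2_D_S_D_T:
  "hirota (D_X * (D_T^2 + D_S) - 4 * D_T) g f P =
    hirota_monom 1 2 0 g f P + hirota_monom 1 0 1 g f P - 4 * hirota_monom 0 1 0 g f P"
proof -
  \<comment> \<open>The numeral 4 is the constant polynomial, with coefficient 4 at exponent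
    \<open>(0, 0, 0)\<close>.\<close>
  have "4 * D_T = (Poly_Mapping.single (0, 1, 0) 4 :: 'a hirota_poly)"
    using mult_single[of "0 :: nat \<times> nat \<times> nat" "4 :: 'a" "(0, 1, 0)" 1]
    by (simp add: D_T_def)
  moreover have "D_X * (D_T^2 + D_S) =
      (Poly_Mapping.single (1, 2, 0) 1 + Poly_Mapping.single (1, 0, 1) 1 :: 'a hirota_poly)"
    by (simp add: D_X_def D_T_def D_S_def power2_eq_square mult_single distrib_left numeral_2_eq_2)
  ultimately show ?thesis
    using hirota_add[of "D_X * (D_T^2 + D_S)" "- (4 * D_T)" g f P]
    by (simp add: hirota_add hirota_uminus hirota_single)
qed

text \<open>
  The hypotheses mirror the structure of tau functions, where
  \<open>\<partial>\<^sub>T\<^sup>2 \<tau> = A + B\<close> and \<open>\<partial>\<^sub>S \<tau> = A - B\<close> for two determinants \<open>A\<close> and \<open>B\<close>.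
\<close>

lemma solves_bilinear_equationsI:
  fixes g f :: "'a::real_normed_field fun3"
  assumes T: "has_partial (0, 1, 0) g gT" "has_partial (0, 1, 0) f fT"
      "has_partial (0, 1, 0) gT (\<lambda>P. gA P + gB P)" "has_partial (0, 1, 0) fT (\<lambda>P. fA P + fB P)"
    and S: "has_partial (0, 0, 1) g (\<lambda>P. gA P - gB P)" "has_partial (0, 0, 1) f (\<lambda>P. fA P - fB P)"
    and X: "has_partial (1, 0, 0) g gX" "has_partial (1, 0, 0) f fX"
      "has_partial (1, 0, 0) gT gTX" "has_partial (1, 0, 0) fT fTX"
      "has_partial (1, 0, 0) gA gAX" "has_partial (1, 0, 0) fA fAX"
      "has_partial (1, 0, 0) gB gBX" "has_partial (1, 0, 0) fB fBX"
    and eq1: "\<And>P. gA P * f P - gT P * fT P + g P * fB P = 0"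
    and eq2: "\<And>P. gAX P * f P - gA P * fX P - gTX P * fT P + gT P * fTX P + gX P * fB P - g P * fBX P
      = 2 * (gT P * f P - g P * fT P)"
  shows "solves_bilinear_equations g f"
proof -
  note dT = doubled_diff_tensor[OF computes_partial_T] doubled_diff_tensor2[OF computes_partial_T]
  note dX = doubled_diff_tensor[OF computes_partial_X] doubled_diff_tensor2[OF computes_partial_X]
    doubled_diff_tensor4[OF computes_partial_X]
  have XS: "has_partial (1, 0, 0) (\<lambda>P. gA P - gB P) (\<lambda>P. gAX P - gBX P)"
    "has_partial (1, 0, 0) (\<lambda>P. fA P - fB P) (\<lambda>P. fAX P - fBX P)"
    "has_partial (1, 0, 0) (\<lambda>P. gA P + gB P) (\<lambda>P. gAX P + gBX P)"
    "has_partial (1, 0, 0) (\<lambda>P. fA P + fB P) (\<lambda>P. fAX P + fBX P)"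
    by (intro has_partial_intros X)+
  have m010: "hirota_monom 0 1 0 g f = (\<lambda>P. gT P * f P - g P * fT P)"
    by (simp add: hirota_monom_def dT(1)[OF T(1,2)])
  have m001: "hirota_monom 0 0 1 g f = (\<lambda>P. (gA P - gB P) * f P - g P * (fA P - fB P))"
    by (simp add: hirota_monom_def doubled_diff_tensor[OF computes_partial_S S])
  have T2: "(doubled_diff partial_T ^^ 2) (\<lambda>P P'. g P * f P') = (\<lambda>P P'.
      ((gA P + gB P) * f P' - gT P * fT P') - (gT P * fT P' - g P * (fA P' + fB P')))"
    by (simp add: numeral_2_eq_2 dT(1)[OF T(1,2)] dT(2)[OF T(3,2,1,4)])
  have m020: "hirota_monom 0 2 0 g f = (\<lambda>P.
      ((gA P + gB P) * f P - gT P * fT P) - (gT P * fT P - g P * (fA P + fB P)))"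
    by (simp add: hirota_monom_def T2)
  have m120: "hirota_monom 1 2 0 g f = (\<lambda>P.
      (((gAX P + gBX P) * f P - gTX P * fT P) - (gTX P * fT P - gX P * (fA P + fB P)))
    - (((gA P + gB P) * fX P - gT P * fTX P) - (gT P * fTX P - g P * (fAX P + fBX P))))"
    by (simp only: hirota_monom_def T2 One_nat_def funpow.simps o_apply id_apply dX(3)[OF XS(3) X(2) X(3,4) X(1) XS(4)])
  have m101: "hirota_monom 1 0 1 g f = (\<lambda>P.
      ((gAX P - gBX P) * f P - gX P * (fA P - fB P)) - ((gA P - gB P) * fX P - g P * (fAX P - fBX P)))"
    by (simp add: hirota_monom_def doubled_diff_tensor[OF computes_partial_S S]
        dX(2)[OF XS(1) X(2) X(1) XS(2)])
  \<comment> \<open>In the sum of the two monomials the products \<open>gB * f\<close> and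
    \<open>g * fA\<close> cancel and the others double; the X-equation below behaves
    likewise.\<close>
  have "hirota (D_T^2 + D_S) g f P = 2 * (gA P * f P - gT P * fT P + g P * fB P)" for P
    unfolding hirota_D_T2_D_S m020 m001 by (simp add: algebra_simps)
  moreover have "hirota (D_X * (D_T^2 + D_S) - 4 * D_T) g f P =
      2 * ((gAX P * f P - gA P * fX P - gTX P * fT P + gT P * fTX P + gX P * fB P - g P * fBX P)
        - 2 * (gT P * f P - g P * fT P))" for P
    unfolding hirota_D_X_D_T2_D_S_D_T m120 m101 m010 by (simp add: algebra_simps)
  ultimately show ?thesis
    by (simp add: solves_bilinear_equations_def eq1 eq2)
qed

subsection \<open>Tau functions\<close>

text \<open>The bracket of the introduction, with \<open>c\<close> giving the upper index at each
  column position.\<close>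

definition shift_det ::
    "nat \<Rightarrow> (nat \<Rightarrow> int \<Rightarrow> 'a::real_normed_field fun3) \<Rightarrow> (nat \<Rightarrow> int) \<Rightarrow> 'a fun3" where
  "shift_det N \<phi> c P = col_det N (\<lambda>j i. \<phi> (i + 1) (c j) P)"

lemma shift_det_cong: "(\<And>j. j < N \<Longrightarrow> c j = d j) \<Longrightarrow> shift_det N \<phi> c P = shift_det N \<phi> d P"
  unfolding shift_det_def by (rule col_det_cong) simp

lemma shift_det_repeat:
  "i < N \<Longrightarrow> j < N \<Longrightarrow> i \<noteq> j \<Longrightarrow> c i = c j \<Longrightarrow> shift_det N \<phi> c P = 0"
  unfolding shift_det_def by (rule col_det_repeat[of i N j]) simp_all

lemma shift_det_swap:
  "i < N \<Longrightarrow> j < N \<Longrightarrow> i \<noteq> j \<Longrightarrow>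
    shift_det N \<phi> (c(i := c j, j := c i)) P = - shift_det N \<phi> c P"
  unfolding shift_det_def
  by (subst col_det_swap[symmetric, of i N j]) (auto intro!: col_det_cong simp: Transposition.transpose_def)

lemma shift_det_pluecker:
  assumes "2 \<le> N" and "\<And>j. 3 \<le> j \<Longrightarrow> j \<le> N \<Longrightarrow> \<exists>l<N. l \<noteq> 0 \<and> y l = w j"
  shows "shift_det N \<phi> (w \<circ> skip 0) P * shift_det N \<phi> (y(0 := w 0)) P
       - shift_det N \<phi> (w \<circ> skip 1) P * shift_det N \<phi> (y(0 := w 1)) P
       + shift_det N \<phi> (w \<circ> skip 2) P * shift_det N \<phi> (y(0 := w 2)) P = 0"
proof -
  let ?col = "\<lambda>n i. \<phi> (i + 1) n P"
  have "shift_det N \<phi> (y(0 := n)) P = col_det N ((?col \<circ> y)(0 := ?col n))" for n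
    unfolding shift_det_def by (rule col_det_cong) simp
  moreover have "shift_det N \<phi> (w \<circ> skip j) P = col_det N ((?col \<circ> w) \<circ> skip j)" for j
    unfolding shift_det_def by (rule col_det_cong) simp
  moreover have "\<exists>l<N. l \<noteq> 0 \<and> (?col \<circ> y) l = (?col \<circ> w) j" if "3 \<le> j" "j \<le> N" for j
    using assms(2)[OF that] by auto
  ultimately show ?thesis
    using pluecker_three_term[of N 0 "?col \<circ> y" "?col \<circ> w"] assms(1) by simp
qed

section \<open>Differentiating determinants column by column\<close>

definition shifted_by ::
    "nat \<Rightarrow> (nat \<Rightarrow> int \<Rightarrow> 'a::real_normed_field fun3) \<Rightarrow> real \<times> real \<times> real \<Rightarrow> int \<Rightarrow> bool" where
  "shifted_by N \<phi> e s \<longleftrightarrow> (\<forall>i\<in>{1..N}. \<forall>n. has_partial e (\<phi> i n) (\<phi> i (n + s)))"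

text \<open>The product rule is applied to each term of the Leibniz formula; exchanging the sums
  over permutations and over differentiated columns reassembles determinants.\<close>

lemma has_partial_shift_det:
  assumes "shifted_by N \<phi> e s"
  shows "has_partial e (shift_det N \<phi> c) (\<lambda>P. \<Sum>k<N. shift_det N \<phi> (c(k := c k + s)) P)"
proof -
  let ?\<Pi> = "{p. p permutes {0..<N}}"
  have "has_partial e (\<lambda>P. \<Prod>j<N. \<phi> (p j + 1) (c j) P)
      (\<lambda>P. \<Sum>k<N. \<phi> (p k + 1) (c k + s) P * (\<Prod>j\<in>{..<N} - {k}. \<phi> (p j + 1) (c j) P))"
    if "p permutes {0..<N}" for p
    by (rule has_partial_prod) (use assms permutes_in_image[OF that] in \<open>auto simp: shifted_by_def Suc_le_eq\<close>)
  moreover have "\<phi> (p k + 1) (c k + s) P * (\<Prod>j\<in>{..<N} - {k}. \<phi> (p j + 1) (c j) P)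
      = (\<Prod>j<N. \<phi> (p j + 1) ((c(k := c k + s)) j) P)" if "k < N" for p k P
    using that by (simp add: prod.remove[of "{..<N}" k])
  ultimately have "has_partial e (\<lambda>P. \<Prod>j<N. \<phi> (p j + 1) (c j) P)
      (\<lambda>P. \<Sum>k<N. \<Prod>j<N. \<phi> (p j + 1) ((c(k := c k + s)) j) P)"
    if "p permutes {0..<N}" for p
    using that by simp
  then have "has_partial e (\<lambda>P. \<Sum>p\<in>?\<Pi>. signof p * (\<Prod>j<N. \<phi> (p j + 1) (c j) P))
      (\<lambda>P. \<Sum>p\<in>?\<Pi>. signof p * (\<Sum>k<N. \<Prod>j<N. \<phi> (p j + 1) ((c(k := c k + s)) j) P))"
    by (intro has_partial_sum has_partial_mult_right) simp
  moreover have "(\<Sum>p\<in>?\<Pi>. signof p * (\<Sum>k<N. \<Prod>j<N. \<phi> (p j + 1) ((c(k := c k + s)) j) P))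
      = (\<Sum>k<N. shift_det N \<phi> (c(k := c k + s)) P)" for P
    unfolding shift_det_def col_det_Leibniz sum_distrib_left by (rule sum.swap)
  ultimately show ?thesis
    unfolding shift_det_def[abs_def] col_det_Leibniz by simp
qed

text \<open>\<open>K\<close> collects the columns whose shift may survive; for any other column
  \<open>k\<close>, \<open>h k\<close> is a column already carrying the shifted index, so that
  determinant vanishes.\<close>

lemma has_partial_shift_det':
  assumes "shifted_by N \<phi> e s"
    and "K \<subseteq> {..<N}" and "\<And>k. k < N \<Longrightarrow> k \<notin> K \<Longrightarrow> h k < N \<and> h k \<noteq> k \<and> c (h k) = c k + s"
    and "\<And>P. (\<Sum>k\<in>K. shift_det N \<phi> (c(k := c k + s)) P) = F P"
  shows "has_partial e (shift_det N \<phi> c) F"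
proof -
  have "shift_det N \<phi> (c(k := c k + s)) P = 0" if "k < N" "k \<notin> K" for k P
    using assms(3)[OF that] that(1) by (intro shift_det_repeat[of k N "h k"]) auto
  then have "(\<Sum>k<N. shift_det N \<phi> (c(k := c k + s)) P) = F P" for P
    using assms(2) unfolding assms(4)[symmetric] by (intro sum.mono_neutral_right) auto
  then show ?thesis
    using has_partial_shift_det[OF assms(1), of c] by simp
qed

lemma tau_eq_shift_det: "tau N \<phi> n = shift_det N \<phi> (\<lambda>j. n + int j)"
  by (simp add: tau_def shift_det_def[abs_def] col_det_def)

lemma solves_bilinear_equations_tau_1:
  assumes X: "shifted_by 1 \<phi> (1, 0, 0) 1"
    and T: "shifted_by 1 \<phi> (0, 1, 0) (-1)"
    and S: "shifted_by 1 \<phi> (0, 0, 1) (-2)"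
  shows "solves_bilinear_equations (tau 1 \<phi> 1) (tau 1 \<phi> 0)"
proof -
  have tau: "tau 1 \<phi> n = \<phi> 1 n" for n
    by (simp add: tau_def det_single fun_eq_iff)
  have X': "has_partial (1, 0, 0) (\<phi> 1 n) (\<phi> 1 m)" if "m = n + 1" for n m
    using X that by (simp add: shifted_by_def)
  have T': "has_partial (0, 1, 0) (\<phi> 1 n) (\<phi> 1 m)" if "m = n - 1" for n m
    using T that by (simp add: shifted_by_def)
  have S': "has_partial (0, 0, 1) (\<phi> 1 n) (\<phi> 1 m)" if "m = n - 2" for n m
    using S that by (simp add: shifted_by_def)
  have zero: "has_partial e (\<lambda>P. 0) (\<lambda>P. 0 :: 'a)" for e
    by (simp add: has_partial_def)
  show ?thesis
    unfolding tau
    by (rule solves_bilinear_equationsI[where gT = "\<phi> 1 0" and fT = "\<phi> 1 (-1)" and gA = "\<phi> 1 (-1)"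
          and fA = "\<phi> 1 (-2)" and gB = "\<lambda>_. 0" and fB = "\<lambda>_. 0" and gX = "\<phi> 1 2" and fX = "\<phi> 1 1"
          and gTX = "\<phi> 1 1" and fTX = "\<phi> 1 0" and gAX = "\<phi> 1 0" and fAX = "\<phi> 1 (-1)"
          and gBX = "\<lambda>_. 0" and fBX = "\<lambda>_. 0"])
      (simp_all add: X' T' S' zero del: One_nat_def)
qed

lemma solves_bilinear_equations_tau_ge_2:
  assumes N: "2 \<le> N"
    and X: "shifted_by N \<phi> (1, 0, 0) 1"
    and T: "shifted_by N \<phi> (0, 1, 0) (-1)"
    and S: "shifted_by N \<phi> (0, 0, 1) (-2)"
  shows "solves_bilinear_equations (tau N \<phi> 1) (tau N \<phi> 0)"
proof -
  define c :: "int \<Rightarrow> nat \<Rightarrow> int" where "c n j = n + int j" for n j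
  let ?D = "shift_det N \<phi>"
  define A where "A n = ?D ((c n)(0 := n - 2))" for n
  define B where "B n = ?D ((c n)(0 := n - 1, 1 := n))" for n
  \<comment> \<open>For \<open>N = 2\<close> the last column of \<open>B 0\<close> is its column 1, so it must not be counted twice.\<close>
  define R where "R = (\<lambda>P. if N = 2 then 0 else ?D ((c 0)(0 := -1, 1 := 0, N - 1 := int N)) P)"
  have tau: "tau N \<phi> n = ?D (c n)" for n
    by (simp add: tau_eq_shift_det c_def[abs_def])

  \<comment> \<open>In T-direction a shifted column collides with its left neighbour, except column
    0 and, once column 0 has moved away, column 1.\<close>
  have dT: "has_partial (0, 1, 0) (?D (c n)) (?D ((c n)(0 := n - 1)))" for n
    by (rule has_partial_shift_det'[where K = "{0}" and h = "\<lambda>k. k - 1", OF T])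
      (use N in \<open>auto simp: c_def\<close>)
  have dTT: "has_partial (0, 1, 0) (?D ((c n)(0 := n - 1))) (\<lambda>P. A n P + B n P)" for n
    by (rule has_partial_shift_det'[where K = "{0, 1}" and h = "\<lambda>k. k - 1", OF T])
      (use N in \<open>auto simp: c_def A_def B_def\<close>)
  \<comment> \<open>The S-shift of column 1 gives indices n, n-1, n+2, ...; exchanging the first two
    columns produces the minus sign of \<open>B\<close> in the S-derivative.\<close>
  have swap: "?D ((c n)(1 := n - 1)) P = - B n P" for n P
    using shift_det_swap[of 0 N 1 \<phi> "(c n)(1 := n - 1)" P] N
    by (simp add: B_def c_def fun_upd_twist)
  have dS: "has_partial (0, 0, 1) (?D (c n)) (\<lambda>P. A n P - B n P)" for n
    by (rule has_partial_shift_det'[where K = "{0, 1}" and h = "\<lambda>k. k - 2", OF S])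
      (use N swap in \<open>auto simp: c_def A_def\<close>)
  \<comment> \<open>In X-direction a shifted column collides with its right neighbour, so only the
    last column and columns left of a gap can contribute.\<close>
  have dX: "has_partial (1, 0, 0) (?D (c n)) (?D ((c n)(N - 1 := n + int N)))" for n
    by (rule has_partial_shift_det'[where K = "{N - 1}" and h = "Suc", OF X])
      (use N in \<open>auto simp: c_def of_nat_diff\<close>)
  have upd0: "(c n)(0 := n) = c n" for n
    by (auto simp: c_def)
  have dTX: "has_partial (1, 0, 0) (?D ((c n)(0 := n - 1)))
      (\<lambda>P. ?D (c n) P + ?D ((c n)(0 := n - 1, N - 1 := n + int N)) P)" for n
    by (rule has_partial_shift_det'[where K = "{0, N - 1}" and h = "Suc", OF X])
      (use N upd0[of n] in \<open>auto simp: c_def of_nat_diff\<close>)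
  have dAX: "has_partial (1, 0, 0) (A n)
      (\<lambda>P. ?D ((c n)(0 := n - 1)) P + ?D ((c n)(0 := n - 2, N - 1 := n + int N)) P)" for n
    unfolding A_def
    by (rule has_partial_shift_det'[where K = "{0, N - 1}" and h = "Suc", OF X])
      (use N in \<open>auto simp: c_def of_nat_diff\<close>)
  \<comment> \<open>Used at \<open>n = 1\<close>, where the X-derivative of \<open>B\<close> cancels
    out of the second equation; the sum is therefore left unsimplified.\<close>
  have dBX: "has_partial (1, 0, 0) (B n)
      (\<lambda>P. \<Sum>k<N. ?D (((c n)(0 := n - 1, 1 := n))(k := ((c n)(0 := n - 1, 1 := n)) k + 1)) P)" for n
    unfolding B_def by (rule has_partial_shift_det[OF X])
  have upd1: "(c 0)(0 := -1, Suc 0 := 1) = (c 0)(0 := -1)"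
    by (auto simp: c_def)
  have dBX0: "has_partial (1, 0, 0) (B 0) (\<lambda>P. ?D ((c 0)(0 := -1)) P + R P)"
    unfolding B_def
    by (rule has_partial_shift_det'[where K = "{1, N - 1}" and h = "Suc", OF X])
      (use N upd1 in \<open>auto simp: c_def R_def of_nat_diff\<close>)

  \<comment> \<open>The N+1 columns -1, 0, ..., N-1 are used: omitting the first, second or third
    gives \<tau>_0, its T-derivative and \<open>B 0\<close>. The last entry of \<open>y\<close>
    stays free, so the last column may be shifted too.\<close>
  have pl: "?D (c 0) P * ?D (y(0 := -1)) P - ?D ((c 0)(0 := -1)) P * ?D (y(0 := 0)) P
      + B 0 P * ?D (y(0 := 1)) P = 0"
    if "\<And>l. 0 < l \<Longrightarrow> l < N - 1 \<Longrightarrow> y l = int l + 1" for y P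
  proof -
    let ?w = "\<lambda>j. int j - 1"
    have "\<exists>l<N. l \<noteq> 0 \<and> y l = ?w j" if "3 \<le> j" "j \<le> N" for j
      using that \<open>\<And>l. 0 < l \<Longrightarrow> l < N - 1 \<Longrightarrow> y l = int l + 1\<close>[of "j - 2"] N
      by (intro exI[of _ "j - 2"]) (auto simp: of_nat_diff)
    moreover have "?w \<circ> skip 0 = c 0" "?w \<circ> skip 1 = (c 0)(0 := -1)"
      "?w \<circ> skip 2 = (c 0)(0 := -1, 1 := 0)"
      by (auto simp: c_def skip_def fun_eq_iff)
    ultimately show ?thesis
      using shift_det_pluecker[of N y ?w \<phi> P] N by (simp add: B_def)
  qed
  have pl1: "A 1 P * ?D (c 0) P - ?D ((c 1)(0 := 0)) P * ?D ((c 0)(0 := -1)) P + ?D (c 1) P * B 0 P = 0" for P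
    using pl[of "c 1" P] upd0[of 1] by (simp add: A_def c_def mult.commute)
  \<comment> \<open>\<open>pl1\<close> with the last column of each \<tau>_1 factor shifted from N
    to N+1.\<close>
  have pl2: "?D ((c 1)(0 := -1, N - 1 := 1 + int N)) P * ?D (c 0) P
      - ?D ((c 1)(0 := 0, N - 1 := 1 + int N)) P * ?D ((c 0)(0 := -1)) P
      + ?D ((c 1)(N - 1 := 1 + int N)) P * B 0 P = 0" for P
  proof -
    have "(c 1)(N - 1 := 1 + int N, 0 := m) = (c 1)(0 := m, N - 1 := 1 + int N)" for m
      using N by (auto simp: fun_upd_twist)
    moreover have "((c 1)(N - 1 := 1 + int N)) l = int l + 1" if "l < N - 1" for l
      using that by (simp add: c_def)
    ultimately show ?thesis
      using pl[of "(c 1)(N - 1 := 1 + int N)" P] upd0[of 1] by (simp add: mult.commute)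
  qed
  \<comment> \<open>\<open>pl1\<close> with the last column of each \<tau>_0 factor shifted from N-1
    to N: the columns are now -1, 0, ..., N-2, N.\<close>
  have pl3: "A 1 P * ?D ((c 0)(N - 1 := int N)) P
      - ?D ((c 1)(0 := 0)) P * ?D ((c 0)(0 := -1, N - 1 := int N)) P + ?D (c 1) P * R P = 0" for P
  proof -
    let ?w = "\<lambda>j. if j = N then int N else int j - 1"
    have ex: "\<exists>l<N. l \<noteq> 0 \<and> c 1 l = ?w j" if "3 \<le> j" "j \<le> N" for j
      using that N by (intro exI[of _ "if j = N then N - 1 else j - 2"]) (auto simp: c_def of_nat_diff)
    have w01: "?D (?w \<circ> skip 0) P = ?D ((c 0)(N - 1 := int N)) P"
      "?D (?w \<circ> skip 1) P = ?D ((c 0)(0 := -1, N - 1 := int N)) P"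
      by (rule shift_det_cong; use N in \<open>auto simp: c_def skip_def\<close>)+
    \<comment> \<open>For \<open>N = 2\<close> the entry \<open>?w 2\<close> is the altered last
      one, equal to 2, which is also the index of column 1 of \<open>c 1\<close>; the product
      vanishes, in agreement with \<open>R\<close>.\<close>
    have w2: "?D (?w \<circ> skip 2) P * ?D ((c 1)(0 := ?w 2)) P = R P * ?D (c 1) P"
    proof (cases "N = 2")
      case True
      then show ?thesis
        using shift_det_repeat[of 0 N 1 "(c 1)(0 := ?w 2)" \<phi> P] by (simp add: R_def c_def)
    next
      case False
      have "?D (?w \<circ> skip 2) P = R P"
        unfolding R_def using False N by (auto intro!: shift_det_cong simp: c_def skip_def)
      then show ?thesis
        using False upd0[of 1] by simp
    qed
    show ?thesis
      using shift_det_pluecker[of N "c 1" ?w \<phi> P, OF N ex] N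
      unfolding w01 w2 by (simp add: A_def mult.commute)
  qed
  \<comment> \<open>The letters \<open>a\<close>, \<open>t\<close>, \<open>s\<close>,
    \<open>r\<close> are the last-column parts of the X-derivatives of \<open>A 1\<close>, of both
    T-derivatives and of \<open>B 0\<close>. They drop out through \<open>pl2\<close> and
    \<open>pl3\<close>; the remaining parts give the right-hand side.\<close>
  have arith: "(gT + a) * f - A * fX - (g + t) * fT + gT * (f + s) + gX * B - g * (fT + r)
      = 2 * (gT * f - g * fT)"
    if "a * f - t * fT + gX * B = 0" "A * fX - gT * s + g * r = 0" for gT a f A fX g t fT s gX B r :: 'a
  proof -
    have "(gT + a) * f - A * fX - (g + t) * fT + gT * (f + s) + gX * B - g * (fT + r)
      = 2 * (gT * f - g * fT) + (a * f - t * fT + gX * B) - (A * fX - gT * s + g * r)"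
      by (simp add: algebra_simps)
    with that show ?thesis
      by simp
  qed
  show ?thesis
    unfolding tau
  proof (rule solves_bilinear_equationsI[OF dT dT dTT dTT dS dS dX dX dTX dTX dAX dAX dBX dBX0])
    fix P
    show "A 1 P * ?D (c 0) P - ?D ((c 1)(0 := 1 - 1)) P * ?D ((c 0)(0 := 0 - 1)) P + ?D (c 1) P * B 0 P = 0"
      using pl1[of P] by simp
    show "(?D ((c 1)(0 := 1 - 1)) P + ?D ((c 1)(0 := 1 - 2, N - 1 := 1 + int N)) P) * ?D (c 0) P
      - A 1 P * ?D ((c 0)(N - 1 := 0 + int N)) P
      - (?D (c 1) P + ?D ((c 1)(0 := 1 - 1, N - 1 := 1 + int N)) P) * ?D ((c 0)(0 := 0 - 1)) P
      + ?D ((c 1)(0 := 1 - 1)) P * (?D (c 0) P + ?D ((c 0)(0 := 0 - 1, N - 1 := 0 + int N)) P)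
      + ?D ((c 1)(N - 1 := 1 + int N)) P * B 0 P - ?D (c 1) P * (?D ((c 0)(0 := -1)) P + R P)
      = 2 * (?D ((c 1)(0 := 1 - 1)) P * ?D (c 0) P - ?D (c 1) P * ?D ((c 0)(0 := 0 - 1)) P)"
      using arith[OF pl2[of P] pl3[of P]] by simp
  qed
qed

subsection \<open>Soliton solutions\<close>

text \<open>A derivative in direction \<open>h\<close> only multiplies the coefficients by
  \<open>L h\<close> and \<open>M h\<close>, so the family is closed under differentiation; hence
  the induction with \<open>a\<close> and \<open>b\<close> arbitrary.\<close>

lemma times_differentiable_exp_sum:
  fixes L M :: "'b::real_normed_vector \<Rightarrow> 'a::{real_normed_field, banach}"
  assumes L: "bounded_linear L" and M: "bounded_linear M"
  shows "times_differentiable k (\<lambda>x. a * exp (L x + u) + b * exp (M x + v))"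
proof (induction k arbitrary: a b)
  case 0
  show ?case
    unfolding times_differentiable.simps by (intro continuous_intros linear_continuous_on L M)
next
  case (Suc k)
  let ?f = "\<lambda>x. a * exp (L x + u) + b * exp (M x + v)"
  have exp: "((\<lambda>x. exp (K x + w)) has_derivative (\<lambda>h. exp (K x + w) * K h)) (at x)"
    if "bounded_linear K" for K :: "'b \<Rightarrow> 'a" and w x
  proof -
    have "((\<lambda>x. K x + w) has_derivative K) (at x)"
      using has_derivative_add[OF bounded_linear_imp_has_derivative[OF that] has_derivative_const]
      by simp
    then show ?thesis
      using has_derivative_compose[where g = exp and g' = "(*) (exp (K x + w))"]
        DERIV_exp[of "K x + w"] unfolding has_field_derivative_def by blast
  qed
  have deriv: "(?f has_derivative (\<lambda>h. a * (exp (L x + u) * L h) + b * (exp (M x + v) * M h))) (at x)"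
    for x
    by (intro has_derivative_add has_derivative_mult_right exp L M)
  then have "frechet_derivative ?f (at x) h = (a * L h) * exp (L x + u) + (b * M h) * exp (M x + v)"
    for x h
    unfolding frechet_derivative_at[OF deriv, symmetric] by (simp add: algebra_simps)
  with Suc deriv show ?case
    by (auto simp: differentiable_def)
qed

lemma smooth_soliton_phi: "smooth (soliton_phi p q \<xi> \<eta> i n)"
proof -
  let ?L = "\<lambda>r. \<lambda>(X, T, S). r * of_real X + 1 / r * of_real T + 1 / r\<^sup>2 * of_real S"
  have L: "bounded_linear (?L r)" for r :: 'a
  proof -
    have "bounded_linear (\<lambda>x :: real \<times> real \<times> real.
        r * of_real (fst x) + 1 / r * of_real (fst (snd x)) + 1 / r\<^sup>2 * of_real (snd (snd x)) :: 'a)"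
      by (intro bounded_linear_add bounded_linear_mult_const bounded_linear_const_mult
          bounded_linear_compose[OF bounded_linear_of_real]
          bounded_linear_fst_comp bounded_linear_snd_comp bounded_linear_ident)
    then show ?thesis
      by (simp add: case_prod_beta')
  qed
  have "times_differentiable k
      (\<lambda>x. p i powi n * exp (?L (p i) x + \<xi> i) + q i powi n * exp (?L (q i) x + \<eta> i))" for k
    by (intro times_differentiable_exp_sum L)
  moreover have "soliton_phi p q \<xi> \<eta> i n =
      (\<lambda>x. p i powi n * exp (?L (p i) x + \<xi> i) + q i powi n * exp (?L (q i) x + \<eta> i))"
    by (auto simp: soliton_phi_def)
  ultimately show ?thesis
    by (simp add: smooth_def)
qed

lemma has_vector_derivative_exp_line:
  fixes a :: "'a::{real_normed_field, banach}"
  shows "((\<lambda>x. c * exp (a * of_real x + u)) has_vector_derivative c * a * exp (a * of_real x + u)) (at x)"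
proof -
  have "((\<lambda>z. c * exp (a * z + u)) has_field_derivative c * a * exp (a * of_real x + u)) (at (of_real x))"
    by (auto intro!: derivative_eq_intros)
  then show ?thesis
    using has_vector_derivative_real_field[of "\<lambda>z. c * exp (a * z + u)"] by simp
qed

text \<open>Differentiating an exponential brings down \<open>r\<close>, \<open>1 / r\<close> or
  \<open>1 / r^2\<close>, which is absorbed into \<open>r powi n\<close> because \<open>r\<close> is
  nonzero.\<close>

lemma dispersion_relations_soliton_phi:
  assumes "\<forall>i\<in>{1..N}. p i \<noteq> 0 \<and> q i \<noteq> 0"
  shows "dispersion_relations N (soliton_phi p q \<xi> \<eta>)"
proof -
  have X: "((\<lambda>x. r powi n * exp (r * of_real x + 1 / r * of_real T + 1 / r\<^sup>2 * of_real S + u))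
      has_vector_derivative
      r powi (n + 1) * exp (r * of_real X + 1 / r * of_real T + 1 / r\<^sup>2 * of_real S + u)) (at X)"
    and T: "((\<lambda>t. r powi n * exp (r * of_real X + 1 / r * of_real t + 1 / r\<^sup>2 * of_real S + u))
      has_vector_derivative
      r powi (n - 1) * exp (r * of_real X + 1 / r * of_real T + 1 / r\<^sup>2 * of_real S + u)) (at T)"
    and S: "((\<lambda>s. r powi n * exp (r * of_real X + 1 / r * of_real T + 1 / r\<^sup>2 * of_real s + u))
      has_vector_derivative
      r powi (n - 2) * exp (r * of_real X + 1 / r * of_real T + 1 / r\<^sup>2 * of_real S + u)) (at S)"
    if "r \<noteq> 0" for r u :: 'a and n X T S
    using
      has_vector_derivative_exp_line[of "r powi n" r "1 / r * of_real T + 1 / r\<^sup>2 * of_real S + u" X]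
      has_vector_derivative_exp_line[of "r powi n" "1 / r" "r * of_real X + 1 / r\<^sup>2 * of_real S + u" T]
      has_vector_derivative_exp_line[of "r powi n" "1 / r\<^sup>2" "r * of_real X + 1 / r * of_real T + u" S]
      that
    by (simp_all add: power_int_add power_int_diff ac_simps)
  show ?thesis
    unfolding dispersion_relations_def soliton_phi_def case_prod_conv
    by (intro ballI allI conjI has_vector_derivative_add X T S) (use assms in auto)
qed

theorem lemma1:
  fixes N :: nat
  assumes "N \<ge> 1"
  shows "(\<forall>\<phi> :: nat \<Rightarrow> int \<Rightarrow> real \<times> real \<times> real \<Rightarrow> 'a::{real_normed_field, banach}.
            (\<forall>i\<in>{1..N}. \<forall>n. smooth (\<phi> i n)) \<longrightarrow>
            dispersion_relations N \<phi> \<longrightarrow>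
            solves_bilinear_equations (tau N \<phi> 1) (tau N \<phi> 0)) \<and>
         (\<forall>p q \<xi> \<eta> :: nat \<Rightarrow> 'a.
            (\<forall>i\<in>{1..N}. p i \<noteq> 0 \<and> q i \<noteq> 0) \<longrightarrow>
            (\<forall>i\<in>{1..N}. \<forall>n. smooth (soliton_phi p q \<xi> \<eta> i n)) \<and>
            dispersion_relations N (soliton_phi p q \<xi> \<eta>) \<and>
            solves_bilinear_equations
              (tau N (soliton_phi p q \<xi> \<eta>) 1) (tau N (soliton_phi p q \<xi> \<eta>) 0))"
proof -
  have bilinear: "solves_bilinear_equations (tau N \<phi> 1) (tau N \<phi> 0)"
    if "dispersion_relations N \<phi>" for \<phi> :: "nat \<Rightarrow> int \<Rightarrow> 'a fun3"
  proof -
    have "shifted_by N \<phi> (1, 0, 0) 1" "shifted_by N \<phi> (0, 1, 0) (-1)" "shifted_by N \<phi> (0, 0, 1) (-2)"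
      using that by (auto simp: dispersion_relations_def shifted_by_def
          has_partial_X_iff has_partial_T_iff has_partial_S_iff)
    moreover have "N = 1 \<or> 2 \<le> N"
      using assms by auto
    ultimately show ?thesis
      using solves_bilinear_equations_tau_1 solves_bilinear_equations_tau_ge_2 by blast
  qed
  then show ?thesis
    by (simp add: smooth_soliton_phi dispersion_relations_soliton_phi)
qed

end
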